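(* Let $(V,H,L)$ be a holonomic space. Then the function $u\mapsto\mathrm{HolRad}(u)$ on $V$ (with values in $(0,\infty]$) is continuous.
   Context: A group-norm on a group $G$ is a function $N:G\to\mathbb{R}$ such that $N(A)\ge 0$; $N(A)=0$ if and only if $A$ is the identity; $N(A^{-1})=N(A)$; and $N(AB)\le N(A)+N(B)$, for all $A,B\in G$. A triplet $(V,H,L)$, with $V$ a normed vector space, $H$ a subgroup of the group of norm-preserving linear automorphisms of $V$, and $L:H\to\mathbb{R}$ a group-norm on $H$, is a holonomic space if: (P) for all $u\in V$ there exists $r>0$ such that for all $v,w\in V$ with $\|v-u\|<r$, $\|w-u\|<r$, and all $A\in H$, $$\|v-w\|^2-\|v-Aw\|^2\le L^2(A).$$ The holonomy radius $\mathrm{HolRad}(u)\in(0,\infty]$ of $u\in V$ is the supremum of the radii $r>0$ for which the condition in (P) holds at $u$. Continuity is with respect to the norm topology on $V$. *)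

theory Defs
  imports "HOL-Analysis.Analysis" "HOL-Algebra.Group"
begin

definition group_norm :: "('g, 'm) monoid_scheme \<Rightarrow> ('g \<Rightarrow> real) \<Rightarrow> bool" where
  "group_norm G N \<longleftrightarrow>
     (\<forall>a\<in>carrier G. N a \<ge> 0) \<and>
     (\<forall>a\<in>carrier G. N a = 0 \<longleftrightarrow> a = \<one>\<^bsub>G\<^esub>) \<and>
     (\<forall>a\<in>carrier G. N (inv\<^bsub>G\<^esub> a) = N a) \<and>
     (\<forall>a\<in>carrier G. \<forall>b\<in>carrier G. N (a \<otimes>\<^bsub>G\<^esub> b) \<le> N a + N b)"

definition linear_isometry_group :: "('v::real_normed_vector \<Rightarrow> 'v) monoid" where
  "linear_isometry_group =
     \<lparr>carrier = {A. linear A \<and> bij A \<and> (\<forall>v. norm (A v) = norm v)},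
      mult = (\<circ>), one = id\<rparr>"

lemma group_linear_isometry_group:
  "group (linear_isometry_group :: ('v::real_normed_vector \<Rightarrow> 'v) monoid)"
proof (rule groupI)
  fix A :: "'v \<Rightarrow> 'v"
  assume "A \<in> carrier linear_isometry_group"
  then have A: "linear A" "bij A" "\<And>v. norm (A v) = norm v"
    by (auto simp: linear_isometry_group_def)
  have surj: "A (inv_into UNIV A v) = v" for v
    using A(2) by (simp add: bij_is_surj surj_f_inv_f)
  have inv_eq: "inv_into UNIV A v = w" if "A w = v" for v w
    using that A(2) by (auto simp: bij_is_inj)
  have "linear (inv_into UNIV A)"
    by (rule linearI; rule inv_eq) (simp_all add: linear_add[OF A(1)] linear_scale[OF A(1)] surj)
  moreover have "norm (inv_into UNIV A v) = norm v" for v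
    using A(3)[of "inv_into UNIV A v"] by (simp add: surj)
  moreover have "inv_into UNIV A \<circ> A = id"
    using A(2) by (simp add: bij_is_inj)
  ultimately show "\<exists>B\<in>carrier linear_isometry_group.
      B \<otimes>\<^bsub>linear_isometry_group\<^esub> A = \<one>\<^bsub>linear_isometry_group\<^esub>"
    using A(2) by (intro bexI[of _ "inv_into UNIV A"])
      (auto simp: linear_isometry_group_def bij_imp_bij_inv)
qed (auto simp: linear_isometry_group_def linear_compose bij_comp linear_id fun_eq_iff)

definition holonomy_condition ::
  "('v::real_normed_vector \<Rightarrow> 'v) set \<Rightarrow> (('v \<Rightarrow> 'v) \<Rightarrow> real) \<Rightarrow> 'v \<Rightarrow> real \<Rightarrow> bool" where
  "holonomy_condition H L u r \<longleftrightarrow>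
     (\<forall>v w. norm (v - u) < r \<longrightarrow> norm (w - u) < r \<longrightarrow>
        (\<forall>A\<in>H. (norm (v - w))\<^sup>2 - (norm (v - A w))\<^sup>2 \<le> (L A)\<^sup>2))"

text \<open>The vector space of the triplet is the type \<^typ>\<open>'v\<close>; only the values of \<open>L\<close> on \<open>H\<close> matter.\<close>

definition holonomic_space ::
  "('v::real_normed_vector \<Rightarrow> 'v) set \<Rightarrow> (('v \<Rightarrow> 'v) \<Rightarrow> real) \<Rightarrow> bool" where
  "holonomic_space H L \<longleftrightarrow>
     subgroup H linear_isometry_group \<and>
     group_norm (linear_isometry_group\<lparr>carrier := H\<rparr>) L \<and>
     (\<forall>u. \<exists>r>0. holonomy_condition H L u r)"

definition HolRad ::
  "('v::real_normed_vector \<Rightarrow> 'v) set \<Rightarrow> (('v \<Rightarrow> 'v) \<Rightarrow> real) \<Rightarrow> 'v \<Rightarrow> ereal" where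
  "HolRad H L u = Sup {ereal r | r. r > 0 \<and> holonomy_condition H L u r}"

end

theory Submission imports Defs begin

text \<open>A ball of radius \<open>r - \<parallel>u - v\<parallel>\<close> around \<open>v\<close> lies in the ball of radius \<open>r\<close> around \<open>u\<close>,
  so the holonomy radius is 1-Lipschitz; in particular, it is infinite everywhere as soon as it is
  infinite somewhere.\<close>

lemma holonomy_condition_shift:
  assumes "holonomy_condition H L u r"
  shows "holonomy_condition H L v (r - norm (u - v))"
  unfolding holonomy_condition_def
proof (intro allI impI ballI)
  fix x y A
  assume x: "norm (x - v) < r - norm (u - v)" and y: "norm (y - v) < r - norm (u - v)" and "A \<in> H"
  have "norm (z - u) \<le> norm (z - v) + norm (u - v)" for z
    using norm_triangle_ineq4[of "z - v" "u - v"] by simp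
  with x y have "norm (x - u) < r" "norm (y - u) < r"
    by (smt (verit))+
  with assms \<open>A \<in> H\<close> show "(norm (x - y))\<^sup>2 - (norm (x - A y))\<^sup>2 \<le> (L A)\<^sup>2"
    by (auto simp: holonomy_condition_def)
qed

lemma HolRad_ge:
  assumes "r > 0" "holonomy_condition H L u r"
  shows "ereal r \<le> HolRad H L u"
  unfolding HolRad_def using assms by (intro Sup_upper) auto

text \<open>This places the values in \<open>{0<..}\<close> and also settles the case of the
  Lipschitz bound in which the shifted radius is not positive.\<close>

lemma HolRad_pos:
  assumes "holonomic_space H L"
  shows "HolRad H L u > 0"
proof -
  obtain r where "r > 0" "holonomy_condition H L u r"
    using assms by (auto simp: holonomic_space_def)
  then show ?thesis
    using HolRad_ge[of r H L u] by (auto intro: less_le_trans[of 0 "ereal r"])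
qed

text \<open>Each admissible radius at \<open>u\<close> is bounded separately, by shifting it to
  \<open>v\<close>. The additive form stays meaningful when both holonomy radii are infinite, unlike
  a bound on their difference.\<close>

lemma HolRad_Lipschitz:
  assumes "holonomic_space H L"
  shows "HolRad H L u \<le> HolRad H L v + ereal (norm (u - v))"
  unfolding HolRad_def[of H L u]
proof (rule Sup_least, clarify)
  fix r :: real
  assume r: "r > 0" "holonomy_condition H L u r"
  have "ereal (r - norm (u - v)) \<le> HolRad H L v"
  proof (cases "r > norm (u - v)")
    case True
    then show ?thesis
      by (intro HolRad_ge holonomy_condition_shift r) simp
  next
    \<comment> \<open>Only positive radii enter the supremum, so the shifted radius is no candidate
      here; positivity of \<open>HolRad H L v\<close> gives the bound instead.\<close>
    case False
    then have "ereal (r - norm (u - v)) \<le> 0"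
      by simp
    also have "\<dots> \<le> HolRad H L v"
      using HolRad_pos[OF assms] by (rule less_imp_le)
    finally show ?thesis .
  qed
  then show "ereal r \<le> HolRad H L v + ereal (norm (u - v))"
    by (cases "HolRad H L v") auto
qed

theorem proposition2p15:
  fixes H :: "('v::real_normed_vector \<Rightarrow> 'v) set" and L :: "('v \<Rightarrow> 'v) \<Rightarrow> real"
  assumes "holonomic_space H L"
  shows "continuous_map euclidean (top_of_set {0<..}) (HolRad H L)"
proof -
  let ?h = "HolRad H L"
  have "(?h \<longlongrightarrow> ?h u) (at u)" for u
  proof (rule tendsto_sandwich)
    have d: "((\<lambda>v. ereal (norm (u - v))) \<longlongrightarrow> ereal 0) (at u)"
      by (rule tendsto_eq_intros | simp)+
    then have d': "((\<lambda>v. ereal (- norm (u - v))) \<longlongrightarrow> ereal 0) (at u)"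
      by (auto dest: tendsto_minus)
    \<comment> \<open>The distance is a finite number, so it can change sides even when a radius is
      infinite.\<close>
    have "?h u + ereal (- norm (u - v)) \<le> ?h v" for v
      using HolRad_Lipschitz[OF assms, of u v] by (cases "?h u"; cases "?h v") auto
    then show "\<forall>\<^sub>F v in at u. ?h u + ereal (- norm (u - v)) \<le> ?h v"
      by simp
    show "\<forall>\<^sub>F v in at u. ?h v \<le> ?h u + ereal (norm (u - v))"
      using HolRad_Lipschitz[OF assms, of _ u] by (simp add: norm_minus_commute)
    \<comment> \<open>Addition in \<open>ereal\<close> respects limits as soon as one of them is
      finite. Here the second is 0, so \<open>?h u\<close> may be infinite.\<close>
    show "((\<lambda>v. ?h u + ereal (- norm (u - v))) \<longlongrightarrow> ?h u) (at u)"
      using tendsto_add_ereal_general1[OF _ tendsto_const[of "?h u"] d'] by simp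
    show "((\<lambda>v. ?h u + ereal (norm (u - v))) \<longlongrightarrow> ?h u) (at u)"
      using tendsto_add_ereal_general1[OF _ tendsto_const[of "?h u"] d] by simp
  qed
  then have "continuous_on UNIV ?h"
    by (simp add: continuous_on_def)
  then show ?thesis
    using HolRad_pos[OF assms] by (auto simp: continuous_map_in_subtopology)
qed

end
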